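(* Let $Q(x,y)=ax^2+bxy+cy^2$ be a primitive positive definite integral binary quadratic form with discriminant $\Delta=b^2-4ac$. (i) For every odd prime $p$, writing $\left(\frac{\Delta}{p}\right)$ for the Legendre symbol, \[ \epsilon_{Q,p}=\begin{cases}1 & \text{if }\left(\frac{\Delta}{p}\right)=0\ (\text{i.e. } p\mid\Delta),\\ 2 & \text{if }\left(\frac{\Delta}{p}\right)=-1,\\ \infty & \text{if }\left(\frac{\Delta}{p}\right)=1.\end{cases} \] (ii) For $p=2$, \[ \epsilon_{Q,2}=\begin{cases}\infty & \text{if }\Delta\equiv 1\pmod 8,\\ 2 & \text{if }\Delta\equiv 5\pmod 8,\\ 3 & \text{if }4\mid\Delta\text{ and }\Delta=-2^3m\text{ with } m \text{ positive and odd},\\ 2 & \text{if }4\mid\Delta\text{ and }\Delta=-2^nm\text{ with } m\text{ positive and odd},\ n\ge 2,\ n\ne 3.\end{cases} \]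
   Context: An integral binary quadratic form $Q(x,y)=ax^2+bxy+cy^2$ has $a,b,c\in\mathbb{Z}$; it is primitive if $\gcd(a,b,c)=1$. For $l\in\mathbb{Z}$ and $k\in\mathbb{Z}_{\ge1}$, write $Q\not\equiv l\pmod k$ if $Q(x,y)\not\equiv l\pmod k$ for all $(x,y)\in\mathbb{Z}^2$. We say $Q$ has a local obstruction modulo $k$ if there exists $l\in\mathbb{Z}$ with $Q\not\equiv l\pmod k$. For a prime $p$, $\epsilon_{Q,p}:=\min\{e\in\mathbb{Z}_{\ge1}\mid Q\text{ has a local obstruction modulo }p^e\}$, with $\epsilon_{Q,p}=\infty$ if $Q$ has no local obstruction modulo $p^e$ for any $e$. *)

theory Defs
  imports "HOL-Number_Theory.Number_Theory" "HOL-Library.Extended_Nat"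
begin

definition qform :: "int \<Rightarrow> int \<Rightarrow> int \<Rightarrow> int \<Rightarrow> int \<Rightarrow> int" where
  "qform a b c x y = a * x\<^sup>2 + b * x * y + c * y\<^sup>2"

definition primitive_form :: "int \<Rightarrow> int \<Rightarrow> int \<Rightarrow> bool" where
  "primitive_form a b c \<longleftrightarrow> Gcd {a, b, c} = 1"

definition disc :: "int \<Rightarrow> int \<Rightarrow> int \<Rightarrow> int" where
  "disc a b c = b\<^sup>2 - 4 * a * c"

(* Positivity is required on nonzero integer vectors only.  For integer coefficients this agrees
   with positivity on nonzero real vectors. *)
definition pos_definite :: "(int \<Rightarrow> int \<Rightarrow> int) \<Rightarrow> bool" where
  "pos_definite Q \<longleftrightarrow> (\<forall>x y. (x, y) \<noteq> (0, 0) \<longrightarrow> Q x y > 0)"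

definition omits_mod :: "(int \<Rightarrow> int \<Rightarrow> int) \<Rightarrow> int \<Rightarrow> nat \<Rightarrow> bool" where
  "omits_mod Q l k \<longleftrightarrow> (\<forall>x y. \<not> [Q x y = l] (mod int k))"

definition local_obstruction :: "(int \<Rightarrow> int \<Rightarrow> int) \<Rightarrow> nat \<Rightarrow> bool" where
  "local_obstruction Q k \<longleftrightarrow> (\<exists>l. omits_mod Q l k)"

definition obstruction_exp :: "(int \<Rightarrow> int \<Rightarrow> int) \<Rightarrow> nat \<Rightarrow> enat" where
  "obstruction_exp Q p =
     (if \<exists>e\<ge>1. local_obstruction Q (p ^ e)
      then enat (LEAST e. e \<ge> 1 \<and> local_obstruction Q (p ^ e))
      else \<infinity>)"

end

theory Submission
  imports Defs
begin

text \<open>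
  All invariants in question depend only on the set of values of \<open>Q\<close>, so for a given prime \<open>p\<close> we
  may replace \<open>Q\<close> by an equivalent form whose leading coefficient \<open>a\<close> is prime to \<open>p\<close>. Completing
  the square, \<open>4 a Q(x, y) = (2 a x + b y)\<^sup>2 - \<Delta> y\<^sup>2\<close>. If \<open>p\<close> divides \<open>\<Delta>\<close>, the values of \<open>4 a Q\<close> modulo
  \<open>p\<close> are squares. If \<open>\<Delta>\<close> is a nonresidue, \<open>p\<close> divides \<open>Q(x, y)\<close> only if it divides \<open>x\<close> and \<open>y\<close>, so
  \<open>p\<close> is omitted modulo \<open>p\<^sup>2\<close>, while the pigeonhole principle shows that nothing is omitted modulo
  \<open>p\<close>. If \<open>\<Delta>\<close> is a nonzero residue (or \<open>\<Delta> \<equiv> 1\<close> modulo 8 when \<open>p = 2\<close>), Hensel lifting splits \<open>a Q\<close>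
  modulo every \<open>p\<^sup>e\<close> into two independent linear factors, which take arbitrary values.
  For \<open>p = 2\<close> and even \<open>b\<close> one uses \<open>a Q(x, y) = u\<^sup>2 - D y\<^sup>2\<close> with \<open>D = \<Delta> / 4\<close> and the squares modulo 8.
\<close>

section \<open>Evaluating the exponent and passing to an equivalent form\<close>

lemma obstruction_exp_eq_enat:
  assumes "e \<ge> 1" "local_obstruction Q (p ^ e)"
    and "\<And>i. 1 \<le> i \<Longrightarrow> i < e \<Longrightarrow> \<not> local_obstruction Q (p ^ i)"
  shows "obstruction_exp Q p = enat e"
proof -
  have "(LEAST i. i \<ge> 1 \<and> local_obstruction Q (p ^ i)) = e"
    using assms by (intro Least_equality) (auto simp: not_less[symmetric])
  then show ?thesis
    using assms unfolding obstruction_exp_def by auto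
qed

lemma obstruction_exp_eq_infinity:
  assumes "\<And>e. \<not> local_obstruction Q (p ^ e)"
  shows "obstruction_exp Q p = \<infinity>"
  using assms unfolding obstruction_exp_def by auto

lemma obstruction_exp_cong_values:
  assumes "\<And>n. (\<exists>x y. Q x y = n) \<longleftrightarrow> (\<exists>x y. R x y = n)"
  shows "obstruction_exp Q p = obstruction_exp R p"
proof -
  have "omits_mod Q l k \<longleftrightarrow> omits_mod R l k" for l k
    unfolding omits_mod_def using assms by metis
  then show ?thesis
    unfolding obstruction_exp_def local_obstruction_def by simp
qed

text \<open>The values at (1,0), (0,1) and (1,1) are \<open>a\<close>, \<open>c\<close> and
  \<open>a + b + c\<close>. If \<open>p\<close> divides the first two, primitivity keeps it from
  dividing \<open>b\<close>, hence from dividing the third. A unimodular substitution makes the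
  chosen value the leading coefficient.\<close>

lemma equivalent_form_leading_coprime:
  assumes "prime (p::int)" "primitive_form a b c"
  obtains a' b' c' where "\<not> p dvd a'" "disc a' b' c' = disc a b c"
    "\<And>n. (\<exists>x y. qform a b c x y = n) \<longleftrightarrow> (\<exists>x y. qform a' b' c' x y = n)"
proof -
  consider "\<not> p dvd a" | "\<not> p dvd c" | "p dvd a" "p dvd c" "\<not> p dvd b"
    using assms not_prime_unit[of p] unfolding primitive_form_def
    by (metis Gcd_greatest empty_iff insert_iff)
  then show ?thesis
  proof cases
    case 1
    then show ?thesis using that by blast
  next
    case 2
    have "qform c b a x y = qform a b c y x" for x y
      unfolding qform_def by Groebner_Basis.algebra
    then show ?thesis
      using that[of c b a] 2 by (force simp: disc_def)
  next
    case 3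
    have "\<not> p dvd a + b + c"
      using 3 by (metis dvd_add_left_iff dvd_add_right_iff)
    moreover have "disc (a + b + c) (b + 2 * c) c = disc a b c"
      unfolding disc_def by Groebner_Basis.algebra
    \<comment> \<open>The shear \<open>(x, y)\<close> to \<open>(x, x + y)\<close> is invertible
      over the integers, so each form takes every value of the other.\<close>
    moreover have "qform (a + b + c) (b + 2 * c) c x y = qform a b c x (x + y)" for x y
      unfolding qform_def by Groebner_Basis.algebra
    moreover from this have "qform (a + b + c) (b + 2 * c) c x (y - x) = qform a b c x y" for x y
      by simp
    ultimately show ?thesis
      using that[of "a + b + c" "b + 2 * c" c] by metis
  qed
qed

section \<open>Completing the square, linear congruences and Hensel lifting\<close>

lemma complete_square_qform:
  "4 * a * qform a b c x y = (2 * a * x + b * y)\<^sup>2 - disc a b c * y\<^sup>2"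
  unfolding qform_def disc_def by Groebner_Basis.algebra

lemma solve_linear_cong:
  assumes "coprime (a::int) m"
  obtains x where "[a * x = b] (mod m)"
proof -
  obtain z where "[a * z = 1] (mod m)"
    using assms cong_solve_coprime_int by blast
  then have "[a * (z * b) = b] (mod m)"
    using cong_scalar_right[of "a * z" 1 m b] by (simp add: mult.assoc)
  then show ?thesis using that by blast
qed

text \<open>Newton iteration for f(T) = T^2 - b T + d: the derivative \<open>2 * s - b\<close> is a
  unit modulo \<open>p\<close>, and a correction of \<open>s\<close> by a multiple of
  \<open>p\<close> leaves it one.\<close>

lemma hensel_monic_quadratic:
  fixes p b d r :: int
  assumes "prime p" "p dvd r\<^sup>2 - b * r + d" "\<not> p dvd 2 * r - b"
  shows "\<exists>s. p ^ e dvd s\<^sup>2 - b * s + d \<and> \<not> p dvd 2 * s - b"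
proof (cases e)
  case 0
  then show ?thesis using assms by auto
next
  case (Suc n)
  have "\<exists>s. p ^ Suc n dvd s\<^sup>2 - b * s + d \<and> \<not> p dvd 2 * s - b"
  proof (induction n)
    case 0
    then show ?case using assms by auto
  next
    case (Suc n)
    then obtain s k where k: "s\<^sup>2 - b * s + d = p ^ Suc n * k" and s: "\<not> p dvd 2 * s - b"
      by (auto elim: dvdE)
    have "coprime (2 * s - b) p"
      using s assms(1) prime_imp_coprime coprime_commute by blast
    \<comment> \<open>Adding \<open>p ^ Suc n * t\<close> to \<open>s\<close> changes f(s) to first
      order by \<open>p ^ Suc n * (2 * s - b) * t\<close>; this \<open>t\<close> cancels
      \<open>k\<close> modulo \<open>p\<close>.\<close>
    then obtain t where "[(2 * s - b) * t = - k] (mod p)"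
      by (rule solve_linear_cong)
    then obtain j where j: "(2 * s - b) * t + k = p * j"
      unfolding cong_iff_dvd_diff by (auto elim: dvdE)
    \<comment> \<open>Naming the power turns the next identities into polynomial ones; the quadratic
      error term is \<open>p ^ Suc (Suc n) * (q * t\<^sup>2)\<close>.\<close>
    define q where "q = p ^ n"
    let ?s = "s + p ^ Suc n * t"
    have "?s\<^sup>2 - b * ?s + d = p ^ Suc (Suc n) * (j + q * t\<^sup>2)"
      using k j unfolding power_Suc q_def[symmetric] by Groebner_Basis.algebra
    moreover have "2 * ?s - b = (2 * s - b) + p * (2 * q * t)"
      unfolding power_Suc q_def[symmetric] by Groebner_Basis.algebra
    then have "\<not> p dvd 2 * ?s - b"
      using s by (metis dvd_add_left_iff dvd_triv_left)
    ultimately show ?case by (metis dvd_triv_left)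
  qed
  then show ?thesis using Suc by simp
qed

text \<open>A lifted root \<open>s\<close> factors \<open>a * Q\<close> modulo \<open>p ^ e\<close>
  as \<open>(a * x + s * y) * (a * x + (b - s) * y)\<close>. The factors can be given the values 1
  and \<open>a * l\<close>, and \<open>a\<close> cancels. Nothing is divided by 2, so
  \<open>p = 2\<close> is covered.\<close>

lemma no_obstruction_if_split:
  fixes a b c r :: int and p :: nat
  assumes p: "prime p" and a: "\<not> int p dvd a"
    and r: "int p dvd r\<^sup>2 - b * r + a * c" "\<not> int p dvd 2 * r - b"
  shows "\<not> local_obstruction (qform a b c) (p ^ e)"
proof -
  define P where "P = int p ^ e"
  have prime: "prime (int p)" using p by simp
  obtain s where s: "P dvd s\<^sup>2 - b * s + a * c" "\<not> int p dvd 2 * s - b"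
    using hensel_monic_quadratic[OF prime r, of e] unfolding P_def by blast
  have cop: "coprime z P" if "\<not> int p dvd z" for z
    using that prime prime_imp_coprime unfolding P_def
    by (metis coprime_commute coprime_power_right_iff)
  have "\<exists>x y. [qform a b c x y = l] (mod P)" for l
  proof -
    have "\<not> int p dvd b - 2 * s"
      using s(2) by (simp add: dvd_diff_commute)
    \<comment> \<open>The factors differ by \<open>(b - 2 * s) * y\<close>, which fixes
      \<open>y\<close>; requiring the first factor to be 1 then fixes \<open>x\<close>.\<close>
    then obtain y where y: "[(b - 2 * s) * y = a * l - 1] (mod P)"
      using cop solve_linear_cong by metis
    obtain x where x: "[a * x = 1 - s * y] (mod P)"
      using cop[OF a] solve_linear_cong by metis
    from y obtain j where j: "(b - 2 * s) * y - (a * l - 1) = P * j"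
      unfolding cong_iff_dvd_diff by (auto elim: dvdE)
    from x obtain i where i: "a * x - (1 - s * y) = P * i"
      unfolding cong_iff_dvd_diff by (auto elim: dvdE)
    from s obtain k where k: "s\<^sup>2 - b * s + a * c = P * k"
      by (auto elim: dvdE)
    have fac: "a * qform a b c x y
        = (a * x + s * y) * (a * x + (b - s) * y) + P * k * y\<^sup>2"
      using k unfolding qform_def by Groebner_Basis.algebra
    have 1: "a * x + s * y = 1 + P * i" using i by simp
    have 2: "a * x + (b - s) * y = a * l + P * (i + j)" using i j by Groebner_Basis.algebra
    have "a * qform a b c x y - a * l = P * (i + j + i * (a * l + P * (i + j)) + k * y\<^sup>2)"
      unfolding fac 1 2 by Groebner_Basis.algebra
    then have "[a * qform a b c x y = a * l] (mod P)"
      by (simp add: cong_iff_dvd_diff)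
    then show ?thesis
      using cop[OF a] cong_mult_lcancel by blast
  qed
  then show ?thesis
    unfolding local_obstruction_def omits_mod_def P_def by simp
qed

section \<open>Odd primes\<close>

text \<open>On this half system \<open>u - v\<close> and \<open>u + v\<close> are too small to be
  nonzero multiples of \<open>p\<close>. General \<open>k\<close> and \<open>n\<close> serve both
  sides of the pigeonhole argument that follows.\<close>

lemma inj_on_square_mod_prime:
  fixes p k :: int
  assumes "prime p" "\<not> p dvd k"
  shows "inj_on (\<lambda>u. (k * u\<^sup>2 + n) mod p) {0..(p - 1) div 2}"
proof (rule inj_onI)
  fix u v assume uv: "u \<in> {0..(p - 1) div 2}" "v \<in> {0..(p - 1) div 2}"
    and "(k * u\<^sup>2 + n) mod p = (k * v\<^sup>2 + n) mod p"
  then have "p dvd (k * u\<^sup>2 + n) - (k * v\<^sup>2 + n)"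
    by (simp add: mod_eq_dvd_iff)
  also have "(k * u\<^sup>2 + n) - (k * v\<^sup>2 + n) = k * ((u - v) * (u + v))"
    by Groebner_Basis.algebra
  finally have "p dvd u - v \<or> p dvd u + v"
    using assms by (simp add: prime_dvd_mult_iff)
  moreover have "\<bar>u - v\<bar> < p" "0 \<le> u + v" "u + v < p"
    using uv prime_gt_1_int[OF assms(1)] by auto
  ultimately have "u - v = 0 \<or> u + v = 0"
    using dvd_imp_le_int[of "u - v" p] zdvd_not_zless[of "u + v" p] by fastforce
  then show "u = v" using uv by auto
qed

text \<open>The residues of \<open>u\<^sup>2\<close> and of \<open>d * v\<^sup>2 + n\<close> form
  two sets of at least (p + 1)/2 elements each, too many to be disjoint among \<open>p\<close>
  residues.\<close>

lemma represent_mod_prime: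
  fixes p d n :: int
  assumes p: "prime p" "odd p" and d: "\<not> p dvd d"
  obtains u v where "[u\<^sup>2 - d * v\<^sup>2 = n] (mod p)"
proof -
  let ?I = "{0..(p - 1) div 2}"
  \<comment> \<open>The trivial factor and summand match the shape of
    \<open>inj_on_square_mod_prime\<close>.\<close>
  define f where "f = (\<lambda>u. (1 * u\<^sup>2 + 0) mod p)"
  define g where "g = (\<lambda>u. (d * u\<^sup>2 + n) mod p)"
  have p1: "p > 1" using p prime_gt_1_int by auto
  have "\<not> p dvd 1" using p1 by simp
  then have inj: "inj_on f ?I" "inj_on g ?I"
    using inj_on_square_mod_prime[OF p(1)] d unfolding f_def g_def by blast+
  have sub: "f ` ?I \<union> g ` ?I \<subseteq> {0..<p}"
    using p1 unfolding f_def g_def by auto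
  have "f ` ?I \<inter> g ` ?I \<noteq> {}"
  proof
    assume "f ` ?I \<inter> g ` ?I = {}"
    then have "card (f ` ?I \<union> g ` ?I) = card ?I + card ?I"
      using inj by (simp add: card_Un_disjoint card_image)
    moreover have "card (f ` ?I \<union> g ` ?I) \<le> card {0..<p}"
      using sub card_mono finite_atLeastLessThan_int by blast
    ultimately show False
      using p1 p(2) by (auto elim!: oddE)
  qed
  then obtain u v where "f u = g v" by blast
  then have "[u\<^sup>2 = d * v\<^sup>2 + n] (mod p)"
    unfolding f_def g_def cong_def by simp
  then have "[u\<^sup>2 - d * v\<^sup>2 = n] (mod p)"
    by (simp add: cong_iff_dvd_diff algebra_simps)
  then show ?thesis using that by blast
qed

text \<open>Squaring identifies 1 with \<open>p - 1\<close>, so on the finite set of residues it is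
  not injective and hence not surjective.\<close>

lemma exists_nonresidue:
  fixes p :: int
  assumes "prime p" "odd p"
  obtains n where "\<And>u. \<not> [u\<^sup>2 = n] (mod p)"
proof -
  have p: "p > 2"
    using assms prime_ge_2_int[of p] by (cases "p = 2") auto
  define f where "f = (\<lambda>u. u\<^sup>2 mod p)"
  have "f 1 = f (p - 1)"
    unfolding f_def by (simp add: mod_eq_dvd_iff power2_eq_square algebra_simps)
  moreover have "1 \<in> {0..<p}" "p - 1 \<in> {0..<p}" "1 \<noteq> p - 1"
    using p by auto
  ultimately have "\<not> inj_on f {0..<p}"
    by (meson inj_onD)
  moreover have "f ` {0..<p} \<subseteq> {0..<p}"
    using p unfolding f_def by auto
  ultimately have "f ` {0..<p} \<noteq> {0..<p}"
    using eq_card_imp_inj_on[of "{0..<p}" f] by auto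
  then obtain n where n: "n \<in> {0..<p}" "n \<notin> f ` {0..<p}"
    using \<open>f ` {0..<p} \<subseteq> {0..<p}\<close> by blast
  have "\<not> [u\<^sup>2 = n] (mod p)" for u
  proof
    assume "[u\<^sup>2 = n] (mod p)"
    then have "f (u mod p) = n"
      using n unfolding f_def cong_def by (simp add: power_mod)
    moreover have "u mod p \<in> {0..<p}" using p by simp
    ultimately show False using n by blast
  qed
  then show ?thesis using that by blast
qed

section \<open>The three values of the Legendre symbol at an odd prime\<close>

context
  fixes a b c :: int and p :: nat
  assumes p: "prime p" "odd p" and a: "\<not> int p dvd a"
begin

private lemma prime_int: "prime (int p)" "odd (int p)"
  using p by auto

private lemma not_dvd_2: "\<not> int p dvd 2"
  using prime_int by (metis primes_dvd_imp_eq two_is_prime_nat prime_nat_int_transfer of_nat_numeral)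

private lemma coprime_2a: "coprime (2 * a) (int p)" "coprime (4 * a) (int p)"
proof -
  have 2: "coprime 2 (int p)" "coprime a (int p)"
    using not_dvd_2 a prime_int prime_imp_coprime coprime_commute by blast+
  then show "coprime (2 * a) (int p)" by simp
  have "coprime (2 * 2) (int p)" using 2 coprime_mult_left_iff by blast
  then show "coprime (4 * a) (int p)" using 2 by simp
qed

lemma obstruction_exp_ramified:
  assumes "int p dvd disc a b c"
  shows "obstruction_exp (qform a b c) p = 1"
proof -
  obtain n where n: "\<And>u. \<not> [u\<^sup>2 = n] (mod int p)"
    using exists_nonresidue prime_int by blast
  \<comment> \<open>The omitted class is the nonresidue \<open>n\<close> divided by the unit
    \<open>4 * a\<close>.\<close>
  obtain l where l: "[4 * a * l = n] (mod int p)"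
    using coprime_2a solve_linear_cong by metis
  have "\<not> [qform a b c x y = l] (mod int p)" for x y
  proof
    assume "[qform a b c x y = l] (mod int p)"
    then have "[4 * a * qform a b c x y = 4 * a * l] (mod int p)"
      by (rule cong_scalar_left)
    then have "[(2 * a * x + b * y)\<^sup>2 - disc a b c * y\<^sup>2 = n] (mod int p)"
      using l cong_trans unfolding complete_square_qform by blast
    moreover have "[(2 * a * x + b * y)\<^sup>2 = (2 * a * x + b * y)\<^sup>2 - disc a b c * y\<^sup>2] (mod int p)"
      using assms by (simp add: cong_iff_dvd_diff)
    ultimately show False
      using n cong_trans by blast
  qed
  then have "local_obstruction (qform a b c) (p ^ 1)"
    unfolding local_obstruction_def omits_mod_def by auto
  then show ?thesis
    using obstruction_exp_eq_enat[of 1] by (simp add: one_enat_def)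
qed

lemma obstruction_exp_inert:
  assumes "\<not> QuadRes (int p) (disc a b c)" "\<not> int p dvd disc a b c"
  shows "obstruction_exp (qform a b c) p = 2"
proof -
  have "\<exists>x y. [qform a b c x y = l] (mod int p)" for l
  proof -
    \<comment> \<open>A representation of \<open>4 * a * l\<close> by the diagonal form pulls back
      to one of \<open>l\<close>, since \<open>u = 2 * a * x + b * y\<close> can be solved for
      \<open>x\<close>.\<close>
    obtain u y where uy: "[u\<^sup>2 - disc a b c * y\<^sup>2 = 4 * a * l] (mod int p)"
      using represent_mod_prime[OF prime_int assms(2)] by blast
    obtain x where "[2 * a * x = u - b * y] (mod int p)"
      using coprime_2a solve_linear_cong by metis
    then have "[2 * a * x + b * y = u] (mod int p)"
      by (simp add: cong_iff_dvd_diff algebra_simps)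
    then have "[(2 * a * x + b * y)\<^sup>2 - disc a b c * y\<^sup>2 = u\<^sup>2 - disc a b c * y\<^sup>2] (mod int p)"
      by (intro cong_diff cong_pow cong_refl)
    then have "[4 * a * qform a b c x y = 4 * a * l] (mod int p)"
      using uy cong_trans unfolding complete_square_qform by blast
    then show ?thesis
      using coprime_2a cong_mult_lcancel by blast
  qed
  then have 1: "\<not> local_obstruction (qform a b c) (p ^ 1)"
    unfolding local_obstruction_def omits_mod_def by simp
  have "\<not> [qform a b c x y = int p] (mod int p ^ 2)" for x y
  proof
    assume cong: "[qform a b c x y = int p] (mod int p ^ 2)"
    then have "int p ^ 2 dvd qform a b c x y - int p"
      by (simp add: cong_iff_dvd_diff)
    then have "int p dvd qform a b c x y - int p"
      by (metis dvd_mult_left power2_eq_square)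
    then have "int p dvd qform a b c x y"
      by (simp add: dvd_diff_left_iff)
    then have dvd: "int p dvd (2 * a * x + b * y)\<^sup>2 - disc a b c * y\<^sup>2"
      by (metis complete_square_qform dvd_mult)
    have y: "int p dvd y"
    proof (rule ccontr)
      \<comment> \<open>Dividing by \<open>y\<^sup>2\<close> would exhibit the discriminant as a
        square modulo \<open>p\<close>.\<close>
      assume "\<not> int p dvd y"
      then have "coprime y (int p)"
        using prime_int prime_imp_coprime coprime_commute by blast
      then obtain z where z: "[y * z = 1] (mod int p)"
        using solve_linear_cong by metis
      have "[(2 * a * x + b * y)\<^sup>2 = disc a b c * y\<^sup>2] (mod int p)"
        using dvd by (simp add: cong_iff_dvd_diff)
      then have "[(2 * a * x + b * y)\<^sup>2 * z\<^sup>2 = disc a b c * y\<^sup>2 * z\<^sup>2] (mod int p)"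
        by (rule cong_scalar_right)
      moreover have "[disc a b c * (y * z)\<^sup>2 = disc a b c * 1\<^sup>2] (mod int p)"
        by (intro cong_scalar_left cong_pow z)
      ultimately have "[((2 * a * x + b * y) * z)\<^sup>2 = disc a b c] (mod int p)"
        unfolding power_mult_distrib using cong_trans by (simp add: mult.assoc) blast
      then show False
        using assms(1) unfolding QuadRes_def by blast
    qed
    then have "int p dvd (2 * a * x + b * y)\<^sup>2"
      using dvd by (metis dvd_diff_left_iff dvd_mult dvd_power_same dvd_power dvd_trans zero_less_numeral)
    then have "int p dvd 2 * a * x + b * y"
      using prime_int prime_dvd_power by blast
    then have "int p dvd 2 * a * x"
      using y by (metis dvd_add_left_iff dvd_mult)
    then have x: "int p dvd x"
      using coprime_2a by (metis coprime_commute coprime_dvd_mult_right_iff)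
    \<comment> \<open>Both arguments are multiples of \<open>p\<close> and the form is homogeneous
      of degree 2; this is incompatible with the value being \<open>p\<close> modulo
      \<open>p ^ 2\<close>.\<close>
    have "int p ^ 2 dvd qform a b c x y"
    proof -
      obtain x' y' where "x = int p * x'" "y = int p * y'"
        using x y by (auto elim!: dvdE)
      then have "qform a b c x y = int p ^ 2 * qform a b c x' y'"
        unfolding qform_def by Groebner_Basis.algebra
      then show ?thesis by simp
    qed
    then have "int p ^ 2 dvd int p"
      using cong cong_dvd_iff by (metis cong_0_iff cong_sym cong_trans)
    then have "int p ^ 2 \<le> int p"
      using prime_int prime_gt_0_int zdvd_imp_le by blast
    then show False
      using prime_gt_1_nat[OF p(1)] by (simp add: power2_eq_square)
  qed
  then have "local_obstruction (qform a b c) (p ^ 2)"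
    unfolding local_obstruction_def omits_mod_def by (auto simp: of_nat_power)
  moreover have "\<not> local_obstruction (qform a b c) (p ^ i)" if "1 \<le> i" "i < 2" for i
  proof -
    have "i = 1" using that by simp
    then show ?thesis using 1 by simp
  qed
  ultimately have "obstruction_exp (qform a b c) p = enat 2"
    by (intro obstruction_exp_eq_enat) auto
  then show ?thesis by (simp add: numeral_eq_enat)
qed

lemma obstruction_exp_split:
  assumes "QuadRes (int p) (disc a b c)" "\<not> int p dvd disc a b c"
  shows "obstruction_exp (qform a b c) p = \<infinity>"
proof -
  obtain s where "[s\<^sup>2 = disc a b c] (mod int p)"
    using assms(1) unfolding QuadRes_def by blast
  then obtain j where j: "s\<^sup>2 - disc a b c = int p * j"
    unfolding cong_iff_dvd_diff by (auto elim: dvdE)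
  have "coprime 2 (int p)" using coprime_2a by simp
  \<comment> \<open>The quadratic formula for T^2 - b T + a c, whose discriminant is
    \<open>disc a b c\<close>. The root is simple because \<open>(2 * r - b)\<^sup>2\<close> is the
    discriminant modulo \<open>p\<close>, hence nonzero.\<close>
  then obtain r where "[2 * r = b + s] (mod int p)"
    using solve_linear_cong by metis
  then obtain i where i: "2 * r - (b + s) = int p * i"
    unfolding cong_iff_dvd_diff by (auto elim: dvdE)
  have "4 * (r\<^sup>2 - b * r + a * c) = int p * (j + 2 * s * i + int p * i\<^sup>2)"
    using i j unfolding disc_def by Groebner_Basis.algebra
  then have "int p dvd (2 * 2) * (r\<^sup>2 - b * r + a * c)" by simp
  then have root: "int p dvd r\<^sup>2 - b * r + a * c"
    using not_dvd_2 prime_int by (metis prime_dvd_mult_iff)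
  have "(2 * r - b)\<^sup>2 = disc a b c + 4 * (r\<^sup>2 - b * r + a * c)"
    unfolding disc_def by Groebner_Basis.algebra
  then have "\<not> int p dvd (2 * r - b)\<^sup>2"
    using root assms(2) by (metis dvd_add_left_iff dvd_mult)
  then have "\<not> int p dvd 2 * r - b"
    by (metis dvd_mult power2_eq_square)
  then show ?thesis
    using no_obstruction_if_split[OF p(1) a root] by (intro obstruction_exp_eq_infinity)
qed

end

section \<open>The prime 2\<close>

lemma square_mod_8_cases:
  fixes u :: int
  shows "u\<^sup>2 mod 8 \<in> {0, 1, 4}"
proof -
  have "u mod 8 \<in> {0, 1, 2, 3, 4, 5, 6, 7}" by auto
  then have "(u mod 8)\<^sup>2 mod 8 \<in> {0, 1, 4}" by auto
  then show ?thesis by (simp add: power_mod)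
qed

text \<open>Reduces values of a diagonal form to the residues of its ingredients, so that finite
  case checks decide them.\<close>

lemma mod_diff_mult:
  fixes u d v m :: int
  shows "(u - d * v) mod m = (u mod m - (d mod m) * (v mod m)) mod m"
proof -
  have "[u - d * v = u mod m - (d mod m) * (v mod m)] (mod m)"
    by (intro cong_diff cong_mult) (simp_all add: cong_def)
  then show ?thesis by (simp only: cong_def)
qed

lemma odd_square_mod_8:
  fixes u :: int
  assumes "odd u"
  shows "u\<^sup>2 mod 8 = 1"
proof -
  have "w mod 8 = 1" if "odd w" "w mod 8 \<in> {0, 1, 4}" for w :: int
    using that by (elim insertE emptyE) presburger+
  from this[of "u\<^sup>2"] show ?thesis using assms square_mod_8_cases[of u] by simp
qed

lemma mod_8_minus_4_times:
  fixes q :: int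
  shows "(1 - 4 * q) mod 8 = (if even q then 1 else 5)"
  by presburger

text \<open>An odd \<open>a\<close> is its own inverse modulo 8, so the class \<open>k * a\<close>
  for a form becomes the class \<open>k\<close> after multiplication by \<open>a\<close>.\<close>

lemma mult_odd_mod_8:
  fixes a q :: int
  assumes "odd a" "[q = k * a] (mod 8)"
  shows "(a * q) mod 8 = k mod 8"
proof -
  have "[a * q = a * (k * a)] (mod 8)" using assms(2) by (rule cong_scalar_left)
  also have "a * (k * a) = k * a\<^sup>2" by Groebner_Basis.algebra
  also have "[k * a\<^sup>2 = k * 1] (mod 8)"
    using odd_square_mod_8[OF assms(1)] by (intro cong_scalar_left) (simp add: cong_def)
  finally show ?thesis by (simp add: cong_def)
qed

section \<open>Forms with odd leading coefficient at the prime 2\<close>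

context
  fixes a b c :: int
  assumes a: "odd a"
begin

text \<open>The values at (0,0) and (1,0) are 0 and the odd number \<open>a\<close>.\<close>

lemma no_obstruction_mod_2: "\<not> local_obstruction (qform a b c) (2 ^ 1)"
proof -
  have "\<exists>x y. [qform a b c x y = l] (mod 2)" for l
  proof (cases "even l")
    case True
    then have "[qform a b c 0 0 = l] (mod 2)"
      by (simp add: qform_def cong_iff_dvd_diff)
    then show ?thesis by blast
  next
    case False
    then have "[qform a b c 1 0 = l] (mod 2)"
      using a by (simp add: qform_def cong_iff_dvd_diff)
    then show ?thesis by blast
  qed
  then show ?thesis
    unfolding local_obstruction_def omits_mod_def by simp
qed

lemma obstruction_exp_2_eq_2:
  assumes "omits_mod (qform a b c) l 4"
  shows "obstruction_exp (qform a b c) 2 = 2"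
proof -
  have "\<not> local_obstruction (qform a b c) (2 ^ i)" if "1 \<le> i" "i < 2" for i
  proof -
    have "i = 1" using that by simp
    then show ?thesis using no_obstruction_mod_2 by simp
  qed
  moreover have "local_obstruction (qform a b c) (2 ^ 2)"
    using assms unfolding local_obstruction_def by auto
  ultimately have "obstruction_exp (qform a b c) 2 = enat 2"
    by (intro obstruction_exp_eq_enat) auto
  then show ?thesis by (simp add: numeral_eq_enat)
qed

text \<open>As \<open>b\<^sup>2\<close> is 1 modulo 8, the discriminant modulo 8 records the parity
  of \<open>a * c\<close>: even for 1, odd for 5.\<close>

lemma odd_disc_imp_odd:
  assumes "odd (disc a b c)"
  shows "odd b" "disc a b c mod 8 = (1 - 4 * (a * c)) mod 8"
proof -
  show "odd b" using assms by (simp add: disc_def)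
  then have "[b\<^sup>2 - 4 * (a * c) = 1 - 4 * (a * c)] (mod 8)"
    using odd_square_mod_8 by (intro cong_diff cong_refl) (simp add: cong_def)
  then show "disc a b c mod 8 = (1 - 4 * (a * c)) mod 8"
    by (simp add: disc_def cong_def mult.assoc)
qed

lemma obstruction_exp_2_split:
  assumes "[disc a b c = 1] (mod 8)"
  shows "obstruction_exp (qform a b c) 2 = \<infinity>"
proof -
  have "disc a b c mod 8 = 1" using assms by (simp add: cong_def)
  moreover from this have "odd (disc a b c)" by presburger
  ultimately have "odd b" "(1 - 4 * (a * c)) mod 8 = 1"
    using odd_disc_imp_odd by simp_all
  then have "even (a * c)"
    unfolding mod_8_minus_4_times by (simp split: if_splits)
  \<comment> \<open>Since \<open>a * c\<close> is even and \<open>b\<close> is odd, 0 is a simple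
    root of T^2 - b T + a c modulo 2.\<close>
  then show ?thesis
    using \<open>odd b\<close> a no_obstruction_if_split[of 2 a 0 b c]
    by (intro obstruction_exp_eq_infinity) simp
qed

text \<open>All three coefficients are odd, so a value is even only when \<open>x\<close> and
  \<open>y\<close> both are, and then it is divisible by 4. Hence 2 is omitted modulo 4.\<close>

lemma obstruction_exp_2_inert:
  assumes "[disc a b c = 5] (mod 8)"
  shows "obstruction_exp (qform a b c) 2 = 2"
proof (rule obstruction_exp_2_eq_2)
  have "disc a b c mod 8 = 5" using assms by (simp add: cong_def)
  moreover from this have "odd (disc a b c)" by presburger
  ultimately have b: "odd b" and "(1 - 4 * (a * c)) mod 8 = 5"
    using odd_disc_imp_odd by simp_all
  then have "odd (a * c)"
    unfolding mod_8_minus_4_times by (simp split: if_splits)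
  then have c: "odd c" by simp
  have "\<not> [qform a b c x y = 2] (mod 4)" for x y
  proof
    assume "[qform a b c x y = 2] (mod 4)"
    then have q: "qform a b c x y mod 4 = 2" by (simp add: cong_def)
    then have "even (qform a b c x y)" by presburger
    then have "even x" "even y"
      using a b c unfolding qform_def by auto
    then obtain x' y' where "x = 2 * x'" "y = 2 * y'"
      by (auto elim!: evenE)
    then have "qform a b c x y = 4 * qform a b c x' y'"
      unfolding qform_def by Groebner_Basis.algebra
    then show False using q by simp
  qed
  then show "omits_mod (qform a b c) 2 4"
    unfolding omits_mod_def by simp
qed

context
  fixes D :: int
  assumes D: "disc a b c = 4 * D"
begin

private lemma even_b: "even b"
proof -
  have "even (b\<^sup>2 - 4 * a * c)" using D unfolding disc_def by simp
  then show ?thesis by simp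
qed

text \<open>For even \<open>b\<close> the factor 4 of \<open>complete_square_qform\<close> cancels,
  leaving only the odd multiplier \<open>a\<close>, which is a unit at 2.\<close>

private lemma complete_square: "a * qform a b c x y = (a * x + b div 2 * y)\<^sup>2 - D * y\<^sup>2"
proof -
  obtain k where k: "b = 2 * k" using even_b by (auto elim: evenE)
  have "D = k\<^sup>2 - a * c" using D unfolding disc_def k by Groebner_Basis.algebra
  moreover have "b div 2 = k" using k by simp
  ultimately show ?thesis unfolding \<open>b div 2 = k\<close> qform_def k by Groebner_Basis.algebra
qed

lemma obstruction_exp_2_unless_2_mod_4:
  assumes "D mod 4 \<noteq> 2"
  shows "obstruction_exp (qform a b c) 2 = 2"
proof -
  \<comment> \<open>Squares modulo 4 are 0 and 1, so \<open>u\<^sup>2 - D * y\<^sup>2\<close> takes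
    the classes {0, 1}, {0, 1, 3} or {0, 1, 2} for \<open>D\<close> congruent to 0, 1 or 3;
    \<open>k\<close> is a missing class.\<close>
  define k :: int where "k = (if D mod 4 = 3 then 3 else 2)"
  have "\<not> [qform a b c x y = k * a] (mod 4)" for x y
  proof
    define u where "u = a * x + b div 2 * y"
    assume "[qform a b c x y = k * a] (mod 4)"
    then have "[a * qform a b c x y = a * (k * a)] (mod 4)"
      by (rule cong_scalar_left)
    also have "a * (k * a) = k * a\<^sup>2" by Groebner_Basis.algebra
    also have "a\<^sup>2 mod 4 = 1" using odd_square_mod_8[OF a] by presburger
    then have "[k * a\<^sup>2 = k * 1] (mod 4)"
      by (intro cong_scalar_left) (simp add: cong_def)
    finally have "(u\<^sup>2 - D * y\<^sup>2) mod 4 = k mod 4"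
      unfolding complete_square u_def by (simp add: cong_def)
    then have eq: "(u\<^sup>2 mod 4 - (D mod 4) * (y\<^sup>2 mod 4)) mod 4 = k mod 4"
      by (subst (asm) mod_diff_mult)
    have sq: "v\<^sup>2 mod 4 \<in> {0, 1}" for v :: int
      using square_mod_8_cases[of v] by (elim insertE emptyE) (simp_all, presburger+)
    have "D mod 4 \<in> {0, 1, 3}"
      using assms by auto
    then show False
      using eq sq[of u] sq[of y] unfolding k_def by (elim insertE emptyE) simp_all
  qed
  then have "omits_mod (qform a b c) (k * a) 4"
    unfolding omits_mod_def by simp
  then show ?thesis by (rule obstruction_exp_2_eq_2)
qed

lemma obstruction_exp_2_if_2_mod_4:
  assumes "D mod 4 = 2"
  shows "obstruction_exp (qform a b c) 2 = 3"
proof -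
  have "\<exists>x y. [qform a b c x y = l] (mod 4)" for l
  proof -
    \<comment> \<open>With \<open>u\<close> and \<open>y\<close> in {0, 1} the values 0, 1,
      \<open>- D\<close> and \<open>1 - D\<close> already cover all classes modulo 4.\<close>
    obtain u y :: int where uy: "(u\<^sup>2 - D * y\<^sup>2) mod 4 = (a * l) mod 4"
    proof -
      have "(a * l) mod 4 \<in> {0, 1, 2, 3}" by auto
      moreover have "(- D) mod 4 = 2" "(1 - D) mod 4 = 3" using assms by presburger+
      ultimately show ?thesis
        using that[of 0 0] that[of 1 0] that[of 0 1] that[of 1 1] by auto
    qed
    have "coprime a (2 ^ 2)"
      using a unfolding coprime_power_right_iff by simp
    then have "coprime a 4" by simp
    then obtain x where "[a * x = u - b div 2 * y] (mod 4)"
      using solve_linear_cong by metis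
    then have "[a * x + b div 2 * y = u] (mod 4)"
      by (simp add: cong_iff_dvd_diff algebra_simps)
    then have "[(a * x + b div 2 * y)\<^sup>2 - D * y\<^sup>2 = u\<^sup>2 - D * y\<^sup>2] (mod 4)"
      by (intro cong_diff cong_pow cong_refl)
    then have "[a * qform a b c x y = a * l] (mod 4)"
      using uy unfolding complete_square cong_def by simp
    then show ?thesis
      using \<open>coprime a 4\<close> cong_mult_lcancel by blast
  qed
  then have 2: "\<not> local_obstruction (qform a b c) (2 ^ 2)"
    unfolding local_obstruction_def omits_mod_def by simp
  \<comment> \<open>For \<open>u\<^sup>2 - D * y\<^sup>2\<close> to be 5 modulo 8, \<open>u\<close>
    must be odd and \<open>D * y\<^sup>2\<close> be 4. But \<open>D * y\<^sup>2\<close> is 0 for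
    even \<open>y\<close> and 2 or 6 for odd \<open>y\<close>.\<close>
  have "\<not> [qform a b c x y = 5 * a] (mod 8)" for x y
  proof
    define u where "u = a * x + b div 2 * y"
    assume "[qform a b c x y = 5 * a] (mod 8)"
    then have "(u\<^sup>2 - D * y\<^sup>2) mod 8 = 5"
      using mult_odd_mod_8[OF a] unfolding complete_square[symmetric] u_def by force
    then have eq: "(u\<^sup>2 mod 8 - (D mod 8) * (y\<^sup>2 mod 8)) mod 8 = 5"
      by (subst (asm) mod_diff_mult)
    have "D mod 8 = 2 \<or> D mod 8 = 6" using assms by presburger
    then show False
      using eq square_mod_8_cases[of u] square_mod_8_cases[of y] by auto
  qed
  then have "local_obstruction (qform a b c) (2 ^ 3)"
    unfolding local_obstruction_def omits_mod_def by auto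
  moreover have "\<not> local_obstruction (qform a b c) (2 ^ i)" if "1 \<le> i" "i < 3" for i
  proof -
    have "i = 1 \<or> i = 2" using that by auto
    then show ?thesis using no_obstruction_mod_2 2 by auto
  qed
  ultimately have "obstruction_exp (qform a b c) 2 = enat 3"
    by (intro obstruction_exp_eq_enat) auto
  then show ?thesis by (simp add: numeral_eq_enat)
qed

end

end

section \<open>Reduction to a leading coefficient prime to \<open>p\<close>, and assembly of the
  cases\<close>

theorem theorem1p2:
  fixes a b c :: int and Q :: "int \<Rightarrow> int \<Rightarrow> int" and \<Delta> :: int
  defines "Q \<equiv> qform a b c" and "\<Delta> \<equiv> disc a b c"
  assumes "primitive_form a b c" and "pos_definite Q"
  shows "(\<forall>p::nat. prime p \<and> odd p \<longrightarrow>
            (Legendre \<Delta> (int p) = 0 \<longleftrightarrow> int p dvd \<Delta>) \<and>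
            (Legendre \<Delta> (int p) = 0 \<longrightarrow> obstruction_exp Q p = 1) \<and>
            (Legendre \<Delta> (int p) = -1 \<longrightarrow> obstruction_exp Q p = 2) \<and>
            (Legendre \<Delta> (int p) = 1 \<longrightarrow> obstruction_exp Q p = \<infinity>)) \<and>
         ([\<Delta> = 1] (mod 8) \<longrightarrow> obstruction_exp Q 2 = \<infinity>) \<and>
         ([\<Delta> = 5] (mod 8) \<longrightarrow> obstruction_exp Q 2 = 2) \<and>
         (\<forall>m::int. 4 dvd \<Delta> \<and> m > 0 \<and> odd m \<and> \<Delta> = - (2 ^ 3 * m) \<longrightarrow>
            obstruction_exp Q 2 = 3) \<and>
         (\<forall>(m::int) (n::nat). 4 dvd \<Delta> \<and> m > 0 \<and> odd m \<and> n \<ge> 2 \<and> n \<noteq> 3 \<and> \<Delta> = - (2 ^ n * m) \<longrightarrow>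
            obstruction_exp Q 2 = 2)"
proof (intro conjI allI impI; (elim conjE)?)
  fix p :: nat assume p: "prime p" "odd p"
  obtain a' b' c' where a': "\<not> int p dvd a'" and disc: "disc a' b' c' = \<Delta>"
    and "\<And>n. (\<exists>x y. Q x y = n) \<longleftrightarrow> (\<exists>x y. qform a' b' c' x y = n)"
    using equivalent_form_leading_coprime[of "int p" a b c] p assms by auto
  then have Q: "obstruction_exp Q p = obstruction_exp (qform a' b' c') p"
    using obstruction_exp_cong_values by blast
  show Legendre_0: "Legendre \<Delta> (int p) = 0 \<longleftrightarrow> int p dvd \<Delta>"
    by (simp add: Legendre_def cong_0_iff)
  show "obstruction_exp Q p = 1" if "Legendre \<Delta> (int p) = 0"
    using that Legendre_0 obstruction_exp_ramified[OF p a'] unfolding Q disc[symmetric] by blast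
  show "obstruction_exp Q p = 2" if "Legendre \<Delta> (int p) = -1"
  proof -
    have "\<not> QuadRes (int p) \<Delta>" "\<not> int p dvd \<Delta>"
      using that by (auto simp: Legendre_def cong_0_iff split: if_splits)
    then show ?thesis
      using obstruction_exp_inert[OF p a'] unfolding Q disc[symmetric] by blast
  qed
  show "obstruction_exp Q p = \<infinity>" if "Legendre \<Delta> (int p) = 1"
  proof -
    have "QuadRes (int p) \<Delta>" "\<not> int p dvd \<Delta>"
      using that by (auto simp: Legendre_def cong_0_iff split: if_splits)
    then show ?thesis
      using obstruction_exp_split[OF p a'] unfolding Q disc[symmetric] by blast
  qed
next
  obtain a' b' c' where a': "odd a'" and disc: "disc a' b' c' = \<Delta>"
    and "\<And>n. (\<exists>x y. Q x y = n) \<longleftrightarrow> (\<exists>x y. qform a' b' c' x y = n)"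
    using equivalent_form_leading_coprime[of 2 a b c] assms by auto
  then have Q: "obstruction_exp Q 2 = obstruction_exp (qform a' b' c') 2"
    using obstruction_exp_cong_values by blast
  show "obstruction_exp Q 2 = \<infinity>" if "[\<Delta> = 1] (mod 8)"
    using that obstruction_exp_2_split[OF a'] unfolding Q disc[symmetric] by blast
  show "obstruction_exp Q 2 = 2" if "[\<Delta> = 5] (mod 8)"
    using that obstruction_exp_2_inert[OF a'] unfolding Q disc[symmetric] by blast
  show "obstruction_exp Q 2 = 3" if "odd m" "\<Delta> = - (2 ^ 3 * m)" for m
  proof -
    have "disc a' b' c' = 4 * (- 2 * m)" using that disc by simp
    moreover have "(- 2 * m) mod 4 = 2" using that(1) by presburger
    ultimately show ?thesis
      using obstruction_exp_2_if_2_mod_4[OF a'] unfolding Q by blast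
  qed
  show "obstruction_exp Q 2 = 2"
    if "odd m" "n \<ge> 2" "n \<noteq> 3" "\<Delta> = - (2 ^ n * m)" for m :: int and n :: nat
  proof -
    \<comment> \<open>A quarter of the discriminant is \<open>- (2 ^ k * m)\<close>: odd for
      \<open>k = 0\<close> and divisible by 4 for \<open>k \<ge> 2\<close>. The class 2 modulo 4
      would need \<open>k = 1\<close>, which is the excluded \<open>n = 3\<close>.\<close>
    obtain k where k: "n = k + 2" using \<open>n \<ge> 2\<close> by (metis add.commute le_Suc_ex)
    have "disc a' b' c' = 4 * (- (2 ^ k * m))" using that disc k by (simp add: power_add)
    moreover have "(- (2 ^ k * m)) mod 4 \<noteq> 2"
    proof (cases "k = 0")
      case True
      then show ?thesis using that(1) by simp presburger
    next
      case False
      then have "2 \<le> k" using \<open>n \<noteq> 3\<close> k by simp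
      then obtain i where "k = i + 2" by (metis add.commute le_Suc_ex)
      then have "- (2 ^ k * m) = 4 * - (2 ^ i * m)" by (simp add: power_add)
      then show ?thesis by (metis mod_mult_self1_is_0 zero_neq_numeral)
    qed
    ultimately show ?thesis
      using obstruction_exp_2_unless_2_mod_4[OF a'] unfolding Q by blast
  qed
qed

end
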